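(* Let $N\ge 1$ and, for $n=1,\dots,N$, let $p_x(n),p_z(n)\in[0,\tfrac12]$, $\gamma_n\in[0,1]$, $u_n\in[-1,1]$. Let $\Phi_n=\Phi^{\mathrm P}_n\circ\Phi^{\mathrm{GAD}}_n$ be the single-qubit channel obtained by applying first the generalized amplitude damping channel with parameters $(\gamma_n,u_n)$ and then the independent $X/Z$ Pauli channel with parameters $(p_x(n),p_z(n))$, and let $\Psi_N=\Phi_N\circ\cdots\circ\Phi_1$. Let $F_{\mathrm e}(N)$ be the entanglement fidelity of $\Psi_N$ and let $\Gamma^{(N)}=\prod_{n=1}^N(1-\gamma_n)$. Let $a_x,a_z,b_x,b_z$ be real SPAM parameters with $0<|a_i|\le 1$ and $|b_i|\le 1-|a_i|$ for $i\in\{x,z\}$, and let $\overline p_{M,\alpha}$, for $\alpha\in\{0,1,+,-\}$ and $M\in\{0,N\}$, be the corresponding observed error probabilities after $M$ cycles. Put $$\Sigma_x(M)=1-\overline p_{M,+}-\overline p_{M,-},\qquad \Sigma_z(M)=1-\overline p_{M,0}-\overline p_{M,1}.$$ Then $\Sigma_x(0)=a_x$ and $\Sigma_z(0)=a_z$. Set $$r(N)=\frac{\Sigma_x(N)\Sigma_z(N)}{4\,\Sigma_x(0)\Sigma_z(0)},\qquad F_{\mathrm e,<}(N)=\frac14\Bigl(1+\frac{\Sigma_x(N)}{\Sigma_x(0)}\Bigr)\Bigl(1+\frac{\Sigma_z(N)}{\Sigma_z(0)}\Bigr).$$ If $\Gamma^{(N)}\neq 0$, then $$F_{\mathrm e}(N)=F_{\mathrm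 e,<}(N)+\Bigl(\frac{1}{\Gamma^{(N)}}-1\Bigr)r(N)\qquad\text{and}\qquad F_{\mathrm e,<}(N)\le F_{\mathrm e}(N).$$ If moreover $\Sigma_z(N)\neq0$, then $$F_{\mathrm e}(N)\le F_{\mathrm e,>}(N):=F_{\mathrm e,<}(N)+\Bigl(\frac{\Sigma_z(0)}{\Sigma_z(N)}-1\Bigr)r(N).$$
   Context: $X,Y,Z$ (also $\sigma_x,\sigma_y,\sigma_z$) are the Pauli matrices, $I$ the $2\times2$ identity. Entanglement fidelity: for a single-qubit channel $\Phi$ (completely positive trace-preserving map on $2\times 2$ matrices) with Kraus operators $\{E_i\}$, $F_{\mathrm e}=\langle\phi|(\mathcal I\otimes\Phi)(|\phi\rangle\langle\phi|)|\phi\rangle=\frac14\sum_i|\mathrm{Tr}(E_i)|^2$, where $|\phi\rangle=\frac1{\sqrt2}(|0\rangle|0\rangle+|1\rangle|1\rangle)$ and $\mathcal I$ is the identity channel. Pauli channel $\Phi^{\mathrm P}_n$ with parameters $p_x=p_x(n),p_z=p_z(n)$: Kraus operators $\sqrt{(1-p_x)(1-p_z)}\,I$, $\sqrt{p_x(1-p_z)}\,X$, $\sqrt{p_z(1-p_x)}\,Z$, $\sqrt{p_xp_z}\,Y$. Generalized amplitude damping channel $\Phi^{\mathrm{GAD}}_n$ with parameters $(\gamma_n,u_n)$: with $p^\infty=\frac{1+u_n}{2}$ and $q^\infty=1-p^\infty$, Kraus operators $\sqrt{p^\infty}\begin{pmatrix}1&0\\0&\sqrt{1-\gamma_n}\end{pmatrix}$,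 $\sqrt{p^\infty}\begin{pmatrix}0&\sqrt{\gamma_n}\\0&0\end{pmatrix}$, $\sqrt{q^\infty}\begin{pmatrix}\sqrt{1-\gamma_n}&0\\0&1\end{pmatrix}$, $\sqrt{q^\infty}\begin{pmatrix}0&0\\\sqrt{\gamma_n}&0\end{pmatrix}$. Pauli-transfer form of $\Psi_M$: the $3\times3$ real matrix $T^{(M)}_{\mathrm{eff}}$ with entries $[T^{(M)}_{\mathrm{eff}}]_{ij}=\frac12\mathrm{Tr}[\sigma_i\Psi_M(\sigma_j)]$ and the vector $t^{(M)}_{\mathrm{eff}}$ with entries $t^{(M)}_{\mathrm{eff},i}=\frac12\mathrm{Tr}[\sigma_i\Psi_M(I)]$; thus a state with Bloch vector $\mathbf r$ is mapped by $\Psi_M$ to the state with Bloch vector $t^{(M)}_{\mathrm{eff}}+T^{(M)}_{\mathrm{eff}}\mathbf r$. $\Psi_0$ is the identity channel, so $T^{(0)}_{\mathrm{eff}}=I$ and $t^{(0)}_{\mathrm{eff}}=0$. SPAM (state preparation and measurement error) model: for $i\in\{x,z\}$ the observed quantities are $t^{(M)}_{\mathrm{obs},i}=t^{(M)}_{\mathrm{eff},i}+b_i[T^{(M)}_{\mathrm{eff}}]_{ii}$ and $[T^{(M)}_{\mathrm{obs}}]_{ii}=a_i[T^{(M)}_{\mathrm{eff}}]_{ii}$, with $a_i,b_i$ independent of $M$. The observed magnetization along axis $i$ when the qubit is initialized in the $\pm1$ eigenstate of $\sigma_i$ is $m^{(M)}_i(\pm i)=t^{(M)}_{\mathrm{obs},i}\pm[T^{(M)}_{\mathrm{obs}}]_{ii}$.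 Observed error probabilities after $M$ cycles for initial state $|\alpha\rangle$: $\overline p_{M,\alpha}=\frac12\bigl(1-s(\alpha)\,m^{(M)}_{h(\alpha)}(s(\alpha)h(\alpha))\bigr)$, where $h(+)=h(-)=x$, $h(0)=h(1)=z$, $s(+)=s(0)=+1$, $s(-)=s(1)=-1$. *)

theory Defs
  imports "HOL-Analysis.Analysis"
begin

text \<open>
  Linear maps on \<open>2 \<times> 2\<close> complex matrices are represented as functions on
  \<open>complex^2^2\<close>. The basis vector \<open>|0\<rangle>\<close> has index \<open>1\<close> and \<open>|1\<rangle>\<close> has index \<open>2\<close>.
\<close>

type_synonym cmat2 = "complex^2^2"
type_synonym qmap = "cmat2 \<Rightarrow> cmat2"

definition dagger :: "complex^'n^'m \<Rightarrow> complex^'m^'n" where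
  "dagger A = (\<chi> i j. cnj (A $ j $ i))"

definition pauli_x :: cmat2 where
  "pauli_x = vector [vector [0, 1], vector [1, 0]]"

definition pauli_y :: cmat2 where
  "pauli_y = vector [vector [0, - \<i>], vector [\<i>, 0]]"

definition pauli_z :: cmat2 where
  "pauli_z = vector [vector [1, 0], vector [0, - 1]]"

text \<open>The axes \<open>x, y, z\<close> are the indices \<open>1, 2, 3\<close> of the type \<open>3\<close>.\<close>

definition pauli :: "3 \<Rightarrow> cmat2" where
  "pauli i = (vector [pauli_x, pauli_y, pauli_z] :: cmat2^3) $ i"

definition kraus_map :: "cmat2 list \<Rightarrow> qmap" where
  "kraus_map Es \<rho> = (\<Sum>E\<leftarrow>Es. E ** \<rho> ** dagger E)"

definition pauli_channel :: "real \<Rightarrow> real \<Rightarrow> qmap" where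
  "pauli_channel px pz = kraus_map
     [sqrt ((1 - px) * (1 - pz)) *\<^sub>R mat 1,
      sqrt (px * (1 - pz)) *\<^sub>R pauli_x,
      sqrt (pz * (1 - px)) *\<^sub>R pauli_z,
      sqrt (px * pz) *\<^sub>R pauli_y]"

definition gad_channel :: "real \<Rightarrow> real \<Rightarrow> qmap" where
  "gad_channel \<gamma> u =
     (let p = (1 + u) / 2; q = 1 - p in kraus_map
       [sqrt p *\<^sub>R vector [vector [1, 0], vector [0, of_real (sqrt (1 - \<gamma>))]],
        sqrt p *\<^sub>R vector [vector [0, of_real (sqrt \<gamma>)], vector [0, 0]],
        sqrt q *\<^sub>R vector [vector [of_real (sqrt (1 - \<gamma>)), 0], vector [0, 1]],
        sqrt q *\<^sub>R vector [vector [0, 0], vector [of_real (sqrt \<gamma>), 0]]])"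

definition cycle_channel :: "real \<Rightarrow> real \<Rightarrow> real \<Rightarrow> real \<Rightarrow> qmap" where
  "cycle_channel px pz \<gamma> u = pauli_channel px pz \<circ> gad_channel \<gamma> u"

primrec eff_channel ::
  "(nat \<Rightarrow> real) \<Rightarrow> (nat \<Rightarrow> real) \<Rightarrow> (nat \<Rightarrow> real) \<Rightarrow> (nat \<Rightarrow> real) \<Rightarrow> nat \<Rightarrow> qmap" where
  "eff_channel px pz \<gamma> u 0 = id"
| "eff_channel px pz \<gamma> u (Suc M) =
     cycle_channel (px (Suc M)) (pz (Suc M)) (\<gamma> (Suc M)) (u (Suc M)) \<circ> eff_channel px pz \<gamma> u M"

text \<open>
  Two-qubit vectors and matrices are indexed by pairs (reference qubit, system qubit).
  For linear \<open>\<Phi>\<close>, \<open>(\<I> \<otimes> \<Phi>) (|i\<rangle>\<langle>j| \<otimes> \<rho>) = |i\<rangle>\<langle>j| \<otimes> \<Phi> \<rho>\<close>; that is, \<open>\<Phi>\<close> acts on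
  each \<open>2 \<times> 2\<close> block obtained by fixing the two reference indices.
\<close>

definition id_tensor :: "qmap \<Rightarrow> complex^(2 \<times> 2)^(2 \<times> 2) \<Rightarrow> complex^(2 \<times> 2)^(2 \<times> 2)" where
  "id_tensor \<Phi> R =
     (\<chi> a b. \<Phi> (\<chi> k l. R $ (fst a, k) $ (fst b, l)) $ snd a $ snd b)"

definition max_entangled :: "complex^(2 \<times> 2)" where
  "max_entangled = (\<chi> a. if fst a = snd a then of_real (1 / sqrt 2) else 0)"

definition outer :: "complex^'n \<Rightarrow> complex^'n^'n" where
  "outer v = (\<chi> a b. v $ a * cnj (v $ b))"

definition expectation_value :: "complex^'n \<Rightarrow> complex^'n^'n \<Rightarrow> complex" where
  "expectation_value v A = (\<Sum>a\<in>UNIV. \<Sum>b\<in>UNIV. cnj (v $ a) * A $ a $ b * v $ b)"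

text \<open>
  The real parts taken below only convert the type: for the Kraus maps considered here, the
  complex values are real (lemmas \<open>fidelity_kraus\<close>, \<open>eff_channel_kraus\<close>,
  \<open>transfer_real\<close> and \<open>eff_channel_hermitian\<close>).
\<close>

definition entanglement_fidelity :: "qmap \<Rightarrow> real" where
  "entanglement_fidelity \<Phi> =
     Re (expectation_value max_entangled (id_tensor \<Phi> (outer max_entangled)))"

definition transfer_matrix :: "qmap \<Rightarrow> real^3^3" where
  "transfer_matrix \<Psi> = (\<chi> i j. Re (trace (pauli i ** \<Psi> (pauli j)) / 2))"

definition transfer_vector :: "qmap \<Rightarrow> real^3" where
  "transfer_vector \<Psi> = (\<chi> i. Re (trace (pauli i ** \<Psi> (mat 1)) / 2))"

text \<open>SPAM model with parameters \<open>a i\<close>, \<open>b i\<close>; only the axes \<open>i = 1\<close> and \<open>i = 3\<close> are used.\<close>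

definition obs_vector :: "(3 \<Rightarrow> real) \<Rightarrow> qmap \<Rightarrow> 3 \<Rightarrow> real" where
  "obs_vector b \<Psi> i = transfer_vector \<Psi> $ i + b i * transfer_matrix \<Psi> $ i $ i"

definition obs_diag :: "(3 \<Rightarrow> real) \<Rightarrow> qmap \<Rightarrow> 3 \<Rightarrow> real" where
  "obs_diag a \<Psi> i = a i * transfer_matrix \<Psi> $ i $ i"

text \<open>The argument \<open>s = \<plusminus>1\<close> selects the eigenstate of \<open>pauli i\<close> that is prepared.\<close>

definition obs_magnetization ::
  "(3 \<Rightarrow> real) \<Rightarrow> (3 \<Rightarrow> real) \<Rightarrow> qmap \<Rightarrow> 3 \<Rightarrow> real \<Rightarrow> real" where
  "obs_magnetization a b \<Psi> i s = obs_vector b \<Psi> i + s * obs_diag a \<Psi> i"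

datatype init_state = Ket0 | Ket1 | KetPlus | KetMinus

fun init_axis :: "init_state \<Rightarrow> 3" where
  "init_axis KetPlus = 1"
| "init_axis KetMinus = 1"
| "init_axis Ket0 = 3"
| "init_axis Ket1 = 3"

fun init_sign :: "init_state \<Rightarrow> real" where
  "init_sign KetPlus = 1"
| "init_sign Ket0 = 1"
| "init_sign KetMinus = - 1"
| "init_sign Ket1 = - 1"

definition obs_error ::
  "(3 \<Rightarrow> real) \<Rightarrow> (3 \<Rightarrow> real) \<Rightarrow> qmap \<Rightarrow> init_state \<Rightarrow> real" where
  "obs_error a b \<Psi> \<alpha> =
     (1 - init_sign \<alpha> * obs_magnetization a b \<Psi> (init_axis \<alpha>) (init_sign \<alpha>)) / 2"

lemma fidelity_add:
  "expectation_value v (id_tensor (\<lambda>\<rho>. \<Phi> \<rho> + \<Psi> \<rho>) R) =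
     expectation_value v (id_tensor \<Phi> R) + expectation_value v (id_tensor \<Psi> R)"
  by (simp add: expectation_value_def id_tensor_def algebra_simps sum.distrib)

lemma sum_pairs_2:
  "(\<Sum>a\<in>UNIV. f a) = f (1, 1) + f (1, 2) + f (2, 1) + f (2, 2)"
  for f :: "2 \<times> 2 \<Rightarrow> complex"
proof -
  have "(\<Sum>a\<in>UNIV. f a) = (\<Sum>i\<in>UNIV. \<Sum>j\<in>UNIV. f (i, j))"
    by (simp add: sum.cartesian_product)
  then show ?thesis by (simp add: sum_2)
qed

lemma fidelity_single:
  "expectation_value max_entangled (id_tensor (\<lambda>\<rho>. E ** \<rho> ** dagger E) (outer max_entangled)) =
     of_real ((cmod (trace E))\<^sup>2 / 4)"
proof -
  define c where "c = complex_of_real (1 / sqrt 2)"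
  have c2: "c * c = 1 / 2" and cc: "cnj c = c"
    by (simp_all add: c_def flip: of_real_mult)
  have me: "max_entangled = (\<chi> a. if fst a = snd a then c else 0)"
    by (simp only: max_entangled_def c_def)
  have "expectation_value max_entangled (id_tensor (\<lambda>\<rho>. E ** \<rho> ** dagger E) (outer max_entangled)) =
      (c * c) * (c * c) * (trace E * cnj (trace E))"
    by (simp add: expectation_value_def id_tensor_def me outer_def
        matrix_matrix_mult_def dagger_def trace_def sum_pairs_2 sum_2 cc)
      (simp add: algebra_simps)
  then have "expectation_value max_entangled
      (id_tensor (\<lambda>\<rho>. E ** \<rho> ** dagger E) (outer max_entangled)) = trace E * cnj (trace E) / 4"
    by (simp add: c2)
  then show ?thesis using complex_norm_square[of "trace E"] by simp
qed

lemma fidelity_kraus: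
  "expectation_value max_entangled (id_tensor (kraus_map Es) (outer max_entangled)) =
     of_real ((\<Sum>E\<leftarrow>Es. (cmod (trace E))\<^sup>2) / 4)"
proof (induction Es)
  case Nil
  then show ?case
    by (simp add: expectation_value_def id_tensor_def kraus_map_def)
next
  case (Cons E Es)
  have "kraus_map (E # Es) = (\<lambda>\<rho>. E ** \<rho> ** dagger E + kraus_map Es \<rho>)"
    by (simp add: kraus_map_def fun_eq_iff)
  then show ?case
    using Cons by (simp add: fidelity_add fidelity_single add_divide_distrib)
qed

lemma dagger_mult: "dagger (A ** B) = dagger B ** dagger A" for A B :: cmat2
  by (simp add: dagger_def matrix_matrix_mult_def vec_eq_iff mult.commute)

lemma kraus_single_comp:
  "E ** kraus_map Fs \<rho> ** dagger E = kraus_map (map (\<lambda>F. E ** F) Fs) \<rho>"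
proof (induction Fs)
  case Nil
  then show ?case
    by (simp add: kraus_map_def matrix_matrix_mult_def vec_eq_iff)
next
  case (Cons F Fs)
  have "E ** (A + B) ** dagger E = E ** A ** dagger E + E ** B ** dagger E" for A B
    by (simp add: matrix_matrix_mult_def vec_eq_iff sum_2 algebra_simps)
  then show ?case
    using Cons by (simp add: kraus_map_def dagger_mult matrix_mul_assoc)
qed

lemma kraus_comp:
  "kraus_map Es \<circ> kraus_map Fs = kraus_map (concat (map (\<lambda>E. map (\<lambda>F. E ** F) Fs) Es))"
proof
  fix \<rho>
  have "(\<Sum>E\<leftarrow>Es. kraus_map (map (\<lambda>F. E ** F) Fs) \<rho>) =
      kraus_map (concat (map (\<lambda>E. map (\<lambda>F. E ** F) Fs) Es)) \<rho>"
    by (induction Es) (simp_all add: kraus_map_def)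
  moreover have "kraus_map Es (kraus_map Fs \<rho>) =
      (\<Sum>E\<leftarrow>Es. kraus_map (map (\<lambda>F. E ** F) Fs) \<rho>)"
    unfolding kraus_single_comp[symmetric] by (simp only: kraus_map_def[of Es])
  ultimately show "(kraus_map Es \<circ> kraus_map Fs) \<rho> =
      kraus_map (concat (map (\<lambda>E. map (\<lambda>F. E ** F) Fs) Es)) \<rho>"
    by simp
qed

lemma eff_channel_kraus: "\<exists>Es. eff_channel px pz \<gamma> u M = kraus_map Es"
proof (induction M)
  case 0
  have "dagger (mat 1) = (mat 1 :: cmat2)"
    by (simp add: dagger_def mat_def vec_eq_iff)
  then have "eff_channel px pz \<gamma> u 0 = kraus_map [mat 1]"
    by (simp add: kraus_map_def fun_eq_iff)
  then show ?case ..
next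
  case (Suc M)
  then obtain Es where "eff_channel px pz \<gamma> u M = kraus_map Es" ..
  then show ?case
    by (auto simp: cycle_channel_def pauli_channel_def gad_channel_def Let_def kraus_comp
        simp del: list.map concat.simps)
qed

lemma dagger_kraus: "dagger \<rho> = \<rho> \<Longrightarrow> dagger (kraus_map Es \<rho>) = kraus_map Es \<rho>"
proof (induction Es)
  case Nil
  then show ?case by (simp add: kraus_map_def dagger_def vec_eq_iff)
next
  case (Cons E Es)
  have c: "cnj (\<rho> $ i $ j) = \<rho> $ j $ i" for i j
    using arg_cong[OF Cons.prems, of "\<lambda>M. M $ j $ i"] by (simp add: dagger_def)
  have "dagger (E ** \<rho> ** dagger E) = E ** \<rho> ** dagger E"
    by (simp add: vec_eq_iff forall_2 dagger_def matrix_matrix_mult_def sum_2 c algebra_simps)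
  moreover have "dagger (A + B) = dagger A + dagger B" for A B :: cmat2
    by (simp add: dagger_def vec_eq_iff)
  ultimately show ?case using Cons by (simp add: kraus_map_def)
qed

lemma eff_channel_hermitian:
  "dagger \<rho> = \<rho> \<Longrightarrow> dagger (eff_channel px pz \<gamma> u M \<rho>) = eff_channel px pz \<gamma> u M \<rho>"
  by (induction M)
    (simp_all add: cycle_channel_def pauli_channel_def gad_channel_def Let_def dagger_kraus)

lemma dagger_pauli: "dagger (pauli i) = pauli i"
  using exhaust_3[of i]
  by (auto simp: pauli_def pauli_x_def pauli_y_def pauli_z_def dagger_def vec_eq_iff forall_2)

lemma transfer_real:
  assumes "dagger A = A"
  shows "Im (trace (pauli i ** A)) = 0"
proof -
  have c: "cnj (A $ k $ l) = A $ l $ k" for k l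
    using arg_cong[OF assms, of "\<lambda>M. M $ l $ k"] by (simp add: dagger_def)
  have p: "cnj (pauli i $ k $ l) = pauli i $ l $ k" for k l
    using arg_cong[OF dagger_pauli, of "\<lambda>M. M $ l $ k" i] by (simp add: dagger_def)
  have "cnj (trace (pauli i ** A)) = trace (pauli i ** A)"
    by (simp add: trace_def matrix_matrix_mult_def sum_2 c p algebra_simps)
  then show ?thesis by (simp add: complex_eq_iff)
qed

end

theory Submission
  imports Defs
begin

text \<open>
  Each cycle, and hence the effective channel, sends the Bloch vector \<open>r\<close> to \<open>T r + t\<close> with
  \<open>T\<close> diagonal and \<open>t\<close> along \<open>z\<close>. The diagonal entries multiply under composition, which gives
  \<open>T\<^sub>x T\<^sub>z = \<Gamma> T\<^sub>y\<close>. Since the fidelity is \<open>(1 + T\<^sub>x + T\<^sub>y + T\<^sub>z) / 4\<close> and \<open>\<Sigma>\<^sub>i(N) = a\<^sub>i T\<^sub>i\<close>, the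
  SPAM parameters cancel in the ratios and \<open>T\<^sub>y\<close> is recovered as \<open>T\<^sub>x T\<^sub>z / \<Gamma>\<close>. The bounds come
  from \<open>0 \<le> T\<^sub>z \<le> \<Gamma> \<le> 1\<close> and \<open>T\<^sub>x \<ge> 0\<close>.
\<close>

text \<open>
  The trace-preserving map with Bloch representation \<open>(x, y, z) \<mapsto> (X x, Y y, Z z + t)\<close>.
\<close>

definition bloch_map :: "real \<Rightarrow> real \<Rightarrow> real \<Rightarrow> real \<Rightarrow> qmap" where
  "bloch_map X Y Z t \<rho> =
     (let s = \<rho>$1$1 + \<rho>$2$2; d = \<rho>$1$1 - \<rho>$2$2; e = \<rho>$1$2 + \<rho>$2$1; f = \<rho>$1$2 - \<rho>$2$1
      in vector [vector [(s + (t * s + Z * d)) / 2, (X * e + Y * f) / 2],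
                 vector [(X * e - Y * f) / 2, (s - (t * s + Z * d)) / 2]])"

lemma bloch_map_nth [simp]:
  "bloch_map X Y Z t \<rho> $ 1 $ 1 =
     (\<rho>$1$1 + \<rho>$2$2 + (t * (\<rho>$1$1 + \<rho>$2$2) + Z * (\<rho>$1$1 - \<rho>$2$2))) / 2"
  "bloch_map X Y Z t \<rho> $ 1 $ 2 = (X * (\<rho>$1$2 + \<rho>$2$1) + Y * (\<rho>$1$2 - \<rho>$2$1)) / 2"
  "bloch_map X Y Z t \<rho> $ 2 $ 1 = (X * (\<rho>$1$2 + \<rho>$2$1) - Y * (\<rho>$1$2 - \<rho>$2$1)) / 2"
  "bloch_map X Y Z t \<rho> $ 2 $ 2 =
     (\<rho>$1$1 + \<rho>$2$2 - (t * (\<rho>$1$1 + \<rho>$2$2) + Z * (\<rho>$1$1 - \<rho>$2$2))) / 2"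
  by (simp_all add: bloch_map_def Let_def)

lemma bloch_map_id: "bloch_map 1 1 1 0 = id"
  by (simp add: fun_eq_iff vec_eq_iff forall_2)

lemma bloch_map_comp:
  "bloch_map X' Y' Z' t' \<circ> bloch_map X Y Z t =
     bloch_map (X' * X) (Y' * Y) (Z' * Z) (t' + Z' * t)"
  by (simp add: fun_eq_iff vec_eq_iff forall_2 field_simps)

lemma kraus_map_Nil: "kraus_map [] \<rho> = 0"
  by (simp add: kraus_map_def)

text \<open>Each Kraus operator occurs twice in its term, so its weight \<open>sqrt c\<close>
  squares to \<open>c\<close>. This removes the square roots of the probabilities from both
  channels.\<close>

lemma kraus_map_Cons_sqrt:
  assumes "0 \<le> c"
  shows "kraus_map ((sqrt c *\<^sub>R E) # Es) \<rho> = c *\<^sub>R (E ** \<rho> ** dagger E) + kraus_map Es \<rho>"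
proof -
  have "(sqrt c *\<^sub>R E) ** \<rho> ** dagger (sqrt c *\<^sub>R E) =
      (sqrt c * sqrt c) *\<^sub>R (E ** \<rho> ** dagger E)"
    by (simp add: matrix_matrix_mult_def dagger_def vec_eq_iff sum_2 scaleR_conv_of_real[where 'a = complex]
        algebra_simps del: real_sqrt_mult_self)
  then show ?thesis
    using assms by (simp add: kraus_map_def)
qed

text \<open>Conjugation by a Pauli matrix keeps its own axis and flips the other two. An axis
  flipped with probability f shrinks by 1 - 2 f, where f is \<open>pz\<close> for x (from Z and Y),
  \<open>px\<close> for z (from X and Y), and \<open>px * (1 - pz) + pz * (1 - px)\<close> for
  y.\<close>

lemma pauli_channel_bloch:
  assumes "px \<in> {0..1}" "pz \<in> {0..1}"
  shows "pauli_channel px pz =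
    bloch_map (1 - 2 * pz) ((1 - 2 * px) * (1 - 2 * pz)) (1 - 2 * px) 0"
  using assms
  by (simp add: fun_eq_iff vec_eq_iff forall_2 pauli_channel_def kraus_map_Cons_sqrt kraus_map_Nil)
    (simp add: matrix_matrix_mult_def dagger_def sum_2 mat_def pauli_x_def pauli_y_def pauli_z_def
      scaleR_conv_of_real[where 'a = complex] algebra_simps)

text \<open>The first two Kraus operators damp towards |0>, the last two towards |1>. Both pairs
  contract the Bloch vector alike, and their z-shifts, plus and minus \<gamma>, average to
  \<open>\<gamma> * (p - q)\<close>.\<close>

lemma gad_channel_bloch:
  assumes "\<gamma> \<in> {0..1}" "u \<in> {-1..1}"
  shows "gad_channel \<gamma> u = bloch_map (sqrt (1 - \<gamma>)) (sqrt (1 - \<gamma>)) (1 - \<gamma>) (\<gamma> * u)"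
proof -
  have "complex_of_real (sqrt \<gamma>) * of_real (sqrt \<gamma>) = of_real \<gamma>"
    and "complex_of_real (sqrt (1 - \<gamma>)) * of_real (sqrt (1 - \<gamma>)) = 1 - of_real \<gamma>"
    using assms by (simp_all flip: of_real_mult)
  \<comment> \<open>The variants with \<open>w\<close> catch squares inside right-nested
    products.\<close>
  then have root: "complex_of_real (sqrt \<gamma>) * of_real (sqrt \<gamma>) = of_real \<gamma>"
      "complex_of_real (sqrt \<gamma>) * (of_real (sqrt \<gamma>) * w) = of_real \<gamma> * w"
      "complex_of_real (sqrt (1 - \<gamma>)) * of_real (sqrt (1 - \<gamma>)) = 1 - of_real \<gamma>"
      "complex_of_real (sqrt (1 - \<gamma>)) * (of_real (sqrt (1 - \<gamma>)) * w) = (1 - of_real \<gamma>) * w" for w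
    by (metis mult.assoc)+
  define p q where "p = (1 + u) / 2" and "q = 1 - p"
  have "0 \<le> p" "0 \<le> q" and u: "u = p - q" and q: "q = 1 - p"
    using assms by (simp_all add: p_def q_def field_simps)
  then have "gad_channel \<gamma> u \<rho> $ i $ j =
      bloch_map (sqrt (1 - \<gamma>)) (sqrt (1 - \<gamma>)) (1 - \<gamma>) (\<gamma> * u) \<rho> $ i $ j" for \<rho> i j
    using exhaust_2[of i] exhaust_2[of j]
    unfolding gad_channel_def Let_def p_def[symmetric] q_def[symmetric]
    by (auto simp: kraus_map_Cons_sqrt kraus_map_Nil)
      (simp_all add: matrix_matrix_mult_def dagger_def sum_2 scaleR_conv_of_real[where 'a = complex] root u,
       simp_all add: q algebra_simps root)
  then show ?thesis
    by (simp add: fun_eq_iff vec_eq_iff)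
qed

text \<open>The shift stays existential: neither the fidelity nor the diagonal of the transfer
  matrix depends on it.\<close>

lemma eff_channel_bloch:
  assumes "\<And>n. n \<in> {1..M} \<Longrightarrow> px n \<in> {0..1}"
    and "\<And>n. n \<in> {1..M} \<Longrightarrow> pz n \<in> {0..1}"
    and "\<And>n. n \<in> {1..M} \<Longrightarrow> \<gamma> n \<in> {0..1}"
    and "\<And>n. n \<in> {1..M} \<Longrightarrow> u n \<in> {-1..1}"
  shows "\<exists>t. eff_channel px pz \<gamma> u M =
    bloch_map (\<Prod>n=1..M. (1 - 2 * pz n) * sqrt (1 - \<gamma> n))
      (\<Prod>n=1..M. (1 - 2 * px n) * (1 - 2 * pz n) * sqrt (1 - \<gamma> n))
      (\<Prod>n=1..M. (1 - 2 * px n) * (1 - \<gamma> n)) t"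
  using assms
proof (induction M)
  case 0
  show ?case
    by (auto simp: bloch_map_id intro!: exI[of _ 0])
next
  case (Suc M)
  obtain t where "eff_channel px pz \<gamma> u M =
    bloch_map (\<Prod>n=1..M. (1 - 2 * pz n) * sqrt (1 - \<gamma> n))
      (\<Prod>n=1..M. (1 - 2 * px n) * (1 - 2 * pz n) * sqrt (1 - \<gamma> n))
      (\<Prod>n=1..M. (1 - 2 * px n) * (1 - \<gamma> n)) t"
    using Suc.IH Suc.prems by fastforce
  moreover have "Suc M \<in> {1..Suc M}"
    by simp
  ultimately show ?case
    using Suc.prems[of "Suc M"]
    by (intro exI) (simp add: cycle_channel_def pauli_channel_bloch gad_channel_bloch
        bloch_map_comp mult.commute del: atLeastAtMost_iff)
qed

lemma entanglement_fidelity_bloch: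
  "entanglement_fidelity (bloch_map X Y Z t) = (1 + X + Y + Z) / 4"
proof -
  define c where "c = complex_of_real (1 / sqrt 2)"
  have c2: "c * c = 1 / 2" and cc: "cnj c = c"
    by (simp_all add: c_def flip: of_real_mult)
  have me: "max_entangled = (\<chi> a. if fst a = snd a then c else 0)"
    by (simp only: max_entangled_def c_def)
  have "expectation_value max_entangled (id_tensor (bloch_map X Y Z t) (outer max_entangled)) =
      (c * c) * (c * c) * of_real (1 + X + Y + Z)"
    by (simp add: expectation_value_def id_tensor_def me outer_def sum_pairs_2 cc field_simps)
  also have "\<dots> = of_real ((1 + X + Y + Z) / 4)"
    by (simp add: c2)
  finally show ?thesis
    by (simp only: entanglement_fidelity_def Re_complex_of_real)
qed

lemma transfer_matrix_bloch:
  "transfer_matrix (bloch_map X Y Z t) $ 1 $ 1 = X"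
  "transfer_matrix (bloch_map X Y Z t) $ 3 $ 3 = Z"
  by (simp_all add: transfer_matrix_def pauli_def pauli_x_def pauli_z_def trace_def
      matrix_matrix_mult_def sum_2 vector_3)

text \<open>Opposite preparations enter with opposite signs, so \<open>obs_vector\<close>, and with
  it \<open>b\<close>, cancels.\<close>

lemma obs_error_contrast:
  "1 - obs_error a b \<Psi> KetPlus - obs_error a b \<Psi> KetMinus = a 1 * transfer_matrix \<Psi> $ 1 $ 1"
  "1 - obs_error a b \<Psi> Ket0 - obs_error a b \<Psi> Ket1 = a 3 * transfer_matrix \<Psi> $ 3 $ 3"
  by (simp_all add: obs_error_def obs_magnetization_def obs_diag_def field_simps)

theorem mainTheorem1:
  fixes N :: nat
    and px pz \<gamma> u :: "nat \<Rightarrow> real"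
    and a b :: "3 \<Rightarrow> real"
  assumes "N \<ge> 1"
    and "\<And>n. n \<in> {1..N} \<Longrightarrow> px n \<in> {0..1/2}"
    and "\<And>n. n \<in> {1..N} \<Longrightarrow> pz n \<in> {0..1/2}"
    and "\<And>n. n \<in> {1..N} \<Longrightarrow> \<gamma> n \<in> {0..1}"
    and "\<And>n. n \<in> {1..N} \<Longrightarrow> u n \<in> {-1..1}"
    and "\<And>i. i \<in> {1, 3} \<Longrightarrow> 0 < \<bar>a i\<bar> \<and> \<bar>a i\<bar> \<le> 1"
    and "\<And>i. i \<in> {1, 3} \<Longrightarrow> \<bar>b i\<bar> \<le> 1 - \<bar>a i\<bar>"
  shows
    "let \<Psi> = eff_channel px pz \<gamma> u;
         Fe = entanglement_fidelity (\<Psi> N);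
         \<Gamma> = (\<Prod>n=1..N. 1 - \<gamma> n);
         p = (\<lambda>M. obs_error a b (\<Psi> M));
         \<Sigma>x = (\<lambda>M. 1 - p M KetPlus - p M KetMinus);
         \<Sigma>z = (\<lambda>M. 1 - p M Ket0 - p M Ket1);
         r = \<Sigma>x N * \<Sigma>z N / (4 * \<Sigma>x 0 * \<Sigma>z 0);
         F_lower = 1/4 * (1 + \<Sigma>x N / \<Sigma>x 0) * (1 + \<Sigma>z N / \<Sigma>z 0);
         F_upper = F_lower + (\<Sigma>z 0 / \<Sigma>z N - 1) * r
     in \<Sigma>x 0 = a 1 \<and> \<Sigma>z 0 = a 3 \<and>
        (\<Gamma> \<noteq> 0 \<longrightarrow>
           Fe = F_lower + (1 / \<Gamma> - 1) * r \<and> F_lower \<le> Fe \<and>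
           (\<Sigma>z N \<noteq> 0 \<longrightarrow> Fe \<le> F_upper))"
proof -
  define X where "X = (\<Prod>n=1..N. (1 - 2 * pz n) * sqrt (1 - \<gamma> n))"
  define Y where "Y = (\<Prod>n=1..N. (1 - 2 * px n) * (1 - 2 * pz n) * sqrt (1 - \<gamma> n))"
  define Z where "Z = (\<Prod>n=1..N. (1 - 2 * px n) * (1 - \<gamma> n))"
  define P where "P = (\<Prod>n=1..N. 1 - 2 * px n)"
  define G where "G = (\<Prod>n=1..N. 1 - \<gamma> n)"
  have a: "a 1 \<noteq> 0" "a 3 \<noteq> 0"
    using assms(6) by force+
  obtain t where N: "eff_channel px pz \<gamma> u N = bloch_map X Y Z t"
    unfolding X_def Y_def Z_def using eff_channel_bloch[of N px pz \<gamma> u] assms(2-5) by fastforce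
  have Z: "Z = P * G" and XZ: "X * Z = G * Y"
    by (simp_all add: X_def Y_def Z_def P_def G_def mult_ac flip: prod.distrib)
  have px: "0 \<le> 1 - 2 * px n" "1 - 2 * px n \<le> 1" and pz: "0 \<le> 1 - 2 * pz n"
    and \<gamma>: "0 \<le> 1 - \<gamma> n" "1 - \<gamma> n \<le> 1" if "n \<in> {1..N}" for n
    using assms(2-4)[OF that] by auto
  have X0: "0 \<le> X" and P: "0 \<le> P" "P \<le> 1" and G: "0 \<le> G" "G \<le> 1"
    unfolding X_def P_def G_def
    by (intro prod_nonneg prod_le_1 ballI conjI mult_nonneg_nonneg real_sqrt_ge_zero
        px pz \<gamma>; assumption)+
  \<comment> \<open>Expanding the product leaves the defect (Y - X Z) / 4, and \<open>XZ\<close>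
    gives Y = X Z / G.\<close>
  have Fe: "(1 + X + Y + Z) / 4 = 1/4 * (1 + X) * (1 + Z) + (1 / G - 1) * (X * Z / 4)"
    if "G \<noteq> 0"
    using that XZ by (simp add: field_simps)
  have lower: "0 \<le> (1 / G - 1) * (X * Z / 4)" if "G \<noteq> 0"
    using that X0 P G by (auto simp: Z)
  have upper: "(1 / G - 1) * (X * Z / 4) \<le> (1 / Z - 1) * (X * Z / 4)" if "G \<noteq> 0" "Z \<noteq> 0"
  proof (rule mult_right_mono)
    \<comment> \<open>Z = P G with P in [0, 1], so the observable Z can replace the unknown G in the
      bound.\<close>
    have "0 < Z" "Z \<le> G"
      using that P G by (auto simp: Z less_le mult_left_le_one_le)
    then show "1 / G - 1 \<le> 1 / Z - 1"
      by (simp add: frac_le)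
    show "0 \<le> X * Z / 4"
      using X0 P G by (simp add: Z)
  qed
  \<comment> \<open>With no cycles all contractions are 1, so the contrasts at M = 0 are
    \<open>a 1\<close> and \<open>a 3\<close>, which cancel from the ratios below.\<close>
  have "eff_channel px pz \<gamma> u 0 = bloch_map 1 1 1 0"
    by (simp add: bloch_map_id)
  moreover have "a 1 * X * (a 3 * Z) / (4 * a 1 * a 3) = X * Z / 4"
    "a 1 * X / a 1 = X" "a 3 * Z / a 3 = Z" "a 3 / (a 3 * Z) = 1 / Z"
    using a by simp_all
  ultimately show ?thesis
    using a Fe lower upper
    by (simp only: Let_def N obs_error_contrast transfer_matrix_bloch entanglement_fidelity_bloch
        flip: G_def) auto
qed

end
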